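(* Let $X$ be a compact metric space and $T\colon X\to X$ continuous. A $\overline{\mathit{fk}}$-Cauchy sequence of generic points uniquely determines a $T$-invariant measure. That is: if $(x^{(n)})_{n=1}^\infty\subset X$ is $\overline{\mathit{fk}}$-Cauchy and each $x^{(n)}$ is a generic point for some $T$-invariant Borel probability measure, then there is exactly one $T$-invariant Borel probability measure $\mu$ on $X$ for which there exists a quasi-orbit $\underline z\in X^\infty$ generic for $\mu$ with $\overline{\mathit{fk}}(\underline x^{(n)}_T,\underline z)\to0$ as $n\to\infty$.
   Context: Let $\rho$ be the metric of $X$. $X^\infty$ is the set of $X$-valued sequences indexed by $\mathbb N\cup\{0\}$; the trajectory of $x\in X$ is $\underline{x}_T=(T^j(x))_{j\ge0}\in X^\infty$. Feldman–Katok pseudometric: for $\underline x=(x_j),\underline z=(z_j)\in X^\infty$, $\delta>0$, $n\in\mathbb N$, an $(n,\delta)$-match is an order-preserving bijection $\pi\colon\mathcal D(\pi)\to\mathcal R(\pi)$ with $\mathcal D(\pi),\mathcal R(\pi)\subset\{0,\dots,n-1\}$ (possibly empty) and $\rho(x_i,z_{\pi(i)})<\delta$ for all $i\in\mathcal D(\pi)$; $|\pi|=|\mathcal D(\pi)|$. Put $\bar f_{n,\delta}(\underline x,\underline z)=1-\frac1n\max\{|\pi|:\pi\text{ is an }(n,\delta)\text{-match}\}$, $\bar f_\delta(\underline x,\underline z)=\limsup_{n\to\infty}\bar f_{n,\delta}(\underline x,\underline z)$, and $\overline{\mathit{fk}}(\underline x,\underline z)=\inf\{\delta>0:\bar f_\delta(\underline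 x,\underline z)<\delta\}$. For $x,z\in X$, $\overline{\mathit{fk}}(x,z)=\overline{\mathit{fk}}(\underline x_T,\underline z_T)$; "$\overline{\mathit{fk}}$-Cauchy" refers to this pseudometric on $X$. A sequence $\underline x\in X^\infty$ is generic for a Borel probability measure $\mu$ if $\frac1n\sum_{j=0}^{n-1}\delta_{x_j}\to\mu$ weak$^*$; a point $x$ is generic for $\mu$ if $\underline x_T$ is. A quasi-orbit is $\underline z\in X^\infty$ such that $\{n\ge0:z_{n+1}\ne T(z_n)\}$ has upper asymptotic density $0$. *)

theory Defs
  imports "HOL-Probability.Probability"
begin

section \<open>The Feldman--Katok pseudometric\<close>

definition fk_match ::
  "nat \<Rightarrow> real \<Rightarrow> (nat \<Rightarrow> 'a::metric_space) \<Rightarrow> (nat \<Rightarrow> 'a) \<Rightarrow>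
    nat set \<Rightarrow> nat set \<Rightarrow> (nat \<Rightarrow> nat) \<Rightarrow> bool" where
  "fk_match n \<delta> x z D R \<pi> \<longleftrightarrow>
     D \<subseteq> {..<n} \<and> R \<subseteq> {..<n} \<and> bij_betw \<pi> D R \<and> mono_on D \<pi> \<and>
     (\<forall>i\<in>D. dist (x i) (z (\<pi> i)) < \<delta>)"

definition fbar_upto ::
  "nat \<Rightarrow> real \<Rightarrow> (nat \<Rightarrow> 'a::metric_space) \<Rightarrow> (nat \<Rightarrow> 'a) \<Rightarrow> real" where
  "fbar_upto n \<delta> x z =
     1 - real (Max {card D | D R \<pi>. fk_match n \<delta> x z D R \<pi>}) / real n"

text \<open>The limit superior is taken in the extended reals, where it always exists.\<close>

definition fbar ::
  "real \<Rightarrow> (nat \<Rightarrow> 'a::metric_space) \<Rightarrow> (nat \<Rightarrow> 'a) \<Rightarrow> ereal" where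
  "fbar \<delta> x z = limsup (\<lambda>n. ereal (fbar_upto n \<delta> x z))"

text \<open>The set below is bounded below by 0 and contains every \<open>\<delta> > 1\<close>, so the
  infimum in the reals is meaningful.\<close>

definition fk :: "(nat \<Rightarrow> 'a::metric_space) \<Rightarrow> (nat \<Rightarrow> 'a) \<Rightarrow> real" where
  "fk x z = Inf {\<delta>. 0 < \<delta> \<and> fbar \<delta> x z < ereal \<delta>}"

definition trajectory :: "('a \<Rightarrow> 'a) \<Rightarrow> 'a \<Rightarrow> nat \<Rightarrow> 'a" where
  "trajectory T x = (\<lambda>j. (T ^^ j) x)"

definition fk_Cauchy :: "('a::metric_space \<Rightarrow> 'a) \<Rightarrow> (nat \<Rightarrow> 'a) \<Rightarrow> bool" where
  "fk_Cauchy T x \<longleftrightarrow>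
     (\<forall>\<epsilon>>0. \<exists>N. \<forall>m\<ge>N. \<forall>n\<ge>N. fk (trajectory T (x m)) (trajectory T (x n)) < \<epsilon>)"

section \<open>Generic sequences\<close>

definition borel_prob :: "'a::topological_space measure \<Rightarrow> bool" where
  "borel_prob \<mu> \<longleftrightarrow> prob_space \<mu> \<and> sets \<mu> = sets borel"

definition invariant_prob :: "('a::topological_space \<Rightarrow> 'a) \<Rightarrow> 'a measure \<Rightarrow> bool" where
  "invariant_prob T \<mu> \<longleftrightarrow> borel_prob \<mu> \<and> distr \<mu> borel T = \<mu>"

text \<open>The measure \<open>(1/n) \<Sum>j<n. \<delta>\<^bsub>x j\<^esub>\<close>, as the pushforward under \<open>x\<close> of the uniform
  distribution on \<open>{0, \<dots>, n - 1}\<close>; see \<open>emeasure_empirical\<close>. The value at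
  \<open>n = 0\<close> is irrelevant for limits.\<close>

definition empirical :: "(nat \<Rightarrow> 'a::topological_space) \<Rightarrow> nat \<Rightarrow> 'a measure" where
  "empirical x n = distr (uniform_count_measure {..<n}) borel x"

lemma emeasure_empirical:
  assumes "n > 0" and A: "A \<in> sets borel"
  shows "emeasure (empirical x n) A =
    ennreal ((1 / real n) * (\<Sum>j<n. measure (return borel (x j)) A))"
proof -
  have m: "x \<in> measurable (uniform_count_measure {..<n}) borel"
    by (auto simp: measurable_def space_uniform_count_measure sets_uniform_count_measure)
  have e: "(\<Sum>j<n. measure (return borel (x j)) A) = real (card (x -` A \<inter> {..<n}))"
    using A by (simp add: measure_return sum.If_cases indicator_def Int_commute vimage_def Int_def)
  have "emeasure (empirical x n) A =
      emeasure (uniform_count_measure {..<n}) (x -` A \<inter> {..<n})"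
    unfolding empirical_def
    by (subst emeasure_distr[OF m A]) (simp add: space_uniform_count_measure)
  also have "\<dots> = ennreal (real (card (x -` A \<inter> {..<n})) / real n)"
    using assms(1)
    by (subst emeasure_uniform_count_measure)
      (auto simp: divide_ennreal ennreal_of_nat_eq_real_of_nat)
  finally show ?thesis by (simp add: e)
qed

text \<open>Testing against all continuous functions is the weak* topology because the
  underlying space is compact wherever this notion is used.\<close>

definition weak_star_lim ::
  "(nat \<Rightarrow> 'a::topological_space measure) \<Rightarrow> 'a measure \<Rightarrow> bool" where
  "weak_star_lim M \<mu> \<longleftrightarrow>
     (\<forall>f::'a \<Rightarrow> real. continuous_on UNIV f \<longrightarrow>
        (\<lambda>n. integral\<^sup>L (M n) f) \<longlonglongrightarrow> integral\<^sup>L \<mu> f)"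

definition generic_seq :: "(nat \<Rightarrow> 'a::topological_space) \<Rightarrow> 'a measure \<Rightarrow> bool" where
  "generic_seq x \<mu> \<longleftrightarrow> borel_prob \<mu> \<and> weak_star_lim (empirical x) \<mu>"

definition generic_point ::
  "('a::topological_space \<Rightarrow> 'a) \<Rightarrow> 'a \<Rightarrow> 'a measure \<Rightarrow> bool" where
  "generic_point T x \<mu> \<longleftrightarrow> generic_seq (trajectory T x) \<mu>"

section \<open>Quasi-orbits\<close>

definition upper_density :: "nat set \<Rightarrow> ereal" where
  "upper_density A = limsup (\<lambda>n. ereal (real (card (A \<inter> {..<n})) / real n))"

definition quasi_orbit :: "('a \<Rightarrow> 'a) \<Rightarrow> (nat \<Rightarrow> 'a) \<Rightarrow> bool" where
  "quasi_orbit T z \<longleftrightarrow> upper_density {n. z (Suc n) \<noteq> T (z n)} = 0"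

end

theory Submission
  imports Defs "HOL-Real_Asymp.Real_Asymp"
begin

text \<open>
  A long match with small distances changes the averages of a continuous function only slightly,
  so if \<open>fk (x n) z \<longlonglongrightarrow> 0\<close>, then the measures of the \<open>x n\<close> converge weakly* to that of \<open>z\<close>. This
  gives uniqueness and the invariance of the limit. For existence, \<open>z\<close> follows \<open>x l\<close> at the times in
  \<open>{m l..<m (Suc l)}\<close> with \<open>m\<close> growing so fast that at time \<open>n \<in> {m l..<m (Suc l)}\<close> the times before
  \<open>m (l - 1)\<close> are negligible: a match of \<open>x k\<close> with \<open>z\<close> is then assembled from one with \<open>x (l - 1)\<close> up to
  time \<open>m l\<close> and one with \<open>x l\<close> up to time \<open>n\<close>. The averages along \<open>z\<close> form Cauchy sequences whose
  limits define a positive functional, which is represented by a measure (Riesz), obtained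
  from the Daniell outer measure of the functional.
\<close>

section \<open>The Riesz representation theorem on a compact metric space\<close>

text \<open>A normalised positive linear functional on C(X). Since HOL functions are total,
  \<open>L\<close> also has values at discontinuous functions; the axioms leave these free.\<close>

locale mean_functional =
  fixes L :: "('a::metric_space \<Rightarrow> real) \<Rightarrow> real"
  assumes compact_UNIV: "compact (UNIV :: 'a set)"
    and L_add: "\<And>f g. continuous_on UNIV f \<Longrightarrow> continuous_on UNIV g \<Longrightarrow>
      L (\<lambda>x. f x + g x) = L f + L g"
    and L_scale: "\<And>c f. continuous_on UNIV f \<Longrightarrow> L (\<lambda>x. c * f x) = c * L f"
    and L_nonneg: "\<And>f. continuous_on UNIV f \<Longrightarrow> (\<And>x. 0 \<le> f x) \<Longrightarrow> 0 \<le> L f"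
    and L_one: "L (\<lambda>x. 1) = 1"
begin

section \<open>Elementary consequences of linearity and positivity\<close>

lemma L_const: "L (\<lambda>x. c) = c"
  using L_scale[of "\<lambda>x. 1" c] L_one by simp

lemma L_diff:
  assumes "continuous_on UNIV f" "continuous_on UNIV g"
  shows "L (\<lambda>x. f x - g x) = L f - L g"
proof -
  have "L (\<lambda>x. (f x - g x) + g x) = L (\<lambda>x. f x - g x) + L g"
    by (intro L_add continuous_intros assms)
  then show ?thesis by simp
qed

lemma L_mono:
  assumes "continuous_on UNIV f" "continuous_on UNIV g" "\<And>x. f x \<le> g x"
  shows "L f \<le> L g"
proof -
  have "0 \<le> L (\<lambda>x. g x - f x)"
    by (intro L_nonneg continuous_intros assms) (simp add: assms)
  then show ?thesis using L_diff assms by simp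
qed

lemma L_sum:
  assumes "\<And>i. i \<in> I \<Longrightarrow> continuous_on UNIV (f i)"
  shows "L (\<lambda>x. \<Sum>i\<in>I. f i x) = (\<Sum>i\<in>I. L (f i))"
  using assms
proof (induction I rule: infinite_finite_induct)
  case (insert i I)
  have "L (\<lambda>x. f i x + (\<Sum>i\<in>I. f i x)) = L (f i) + L (\<lambda>x. \<Sum>i\<in>I. f i x)"
    by (intro L_add continuous_intros insert.prems) auto
  then show ?case using insert by simp
qed (use L_const[of 0] in simp_all)

section \<open>Daniell's outer measure\<close>

definition covers :: "'a set \<Rightarrow> (nat \<Rightarrow> 'a \<Rightarrow> real) set" where
  "covers A = {f. (\<forall>n. continuous_on UNIV (f n)) \<and> (\<forall>n x. 0 \<le> f n x) \<and>
     (\<forall>x. incseq (\<lambda>n. f n x)) \<and> (\<forall>x\<in>A. \<exists>n. 1 \<le> f n x)}"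

text \<open>The Daniell upper integral of the indicator of \<open>A\<close>. Increasing sequences,
  rather than single continuous functions, give countable subadditivity; a cover reaches 1 at a
  finite stage, so covering is decided at each point by one index.\<close>

definition outer :: "'a set \<Rightarrow> ennreal" where
  "outer A = (INF f\<in>covers A. SUP n. ennreal (L (f n)))"

lemma outer_le:
  "f \<in> covers A \<Longrightarrow> (\<And>n. ennreal (L (f n)) \<le> c) \<Longrightarrow> outer A \<le> c"
  unfolding outer_def by (rule INF_lower2) (auto intro: SUP_least)

lemma outer_le_functional:
  assumes "continuous_on UNIV g" "\<And>x. 0 \<le> g x" "\<And>x. x \<in> A \<Longrightarrow> 1 \<le> g x"
  shows "outer A \<le> ennreal (L g)"
  by (rule outer_le[of "\<lambda>n. g"]) (auto simp: covers_def assms incseq_def)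

lemma outer_empty: "outer {} = 0"
proof -
  have "outer {} \<le> ennreal (L (\<lambda>x. 0))"
    by (rule outer_le_functional) auto
  then show ?thesis by (simp add: L_const)
qed

lemma outer_mono: "A \<subseteq> B \<Longrightarrow> outer A \<le> outer B"
  unfolding outer_def by (rule INF_superset_mono) (auto simp: covers_def)

text \<open>Covers of the \<open>A i\<close> that are optimal up to \<open>e * (1/2)^Suc i\<close>
  are added along the diagonal, and the errors sum to \<open>e\<close>.\<close>

lemma outer_UN_le: "outer (\<Union>i. A i) \<le> (\<Sum>i::nat. outer (A i))"
proof (rule ennreal_le_epsilon)
  fix e :: real assume fin: "(\<Sum>i. outer (A i)) < top" and "0 < e"
  \<comment> \<open>Finiteness of the whole sum makes each \<open>outer (A n)\<close> finite, so the
    inequality is strict and a cover below the right side exists.\<close>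
  have *: "outer (A n) < outer (A n) + e * (1/2)^Suc n" for n
    using fin \<open>0 < e\<close> by (auto simp add: less_top dest!: ennreal_suminf_lessD)
  have "\<exists>f\<in>covers (A i). (SUP n. ennreal (L (f n))) < outer (A i) + e * (1/2)^Suc i" for i
    using *[of i] unfolding outer_def by (simp add: INF_less_iff)
  then obtain f where f: "\<And>i. f i \<in> covers (A i)"
    and fl: "\<And>i. (SUP n. ennreal (L (f i n))) < outer (A i) + e * (1/2)^Suc i"
    by metis
  have cf: "continuous_on UNIV (f i n)" and pf: "0 \<le> f i n x" for i n x
    using f[of i] by (auto simp: covers_def)
  have mf: "f i m x \<le> f i n x" if "m \<le> n" for i m n x
    using f[of i] that by (auto simp: covers_def incseq_def)
  \<comment> \<open>Stage \<open>n\<close> is a finite sum of continuous functions; it increases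
    because both the number of nonnegative summands and each summand grow.\<close>
  define g where "g n = (\<lambda>x. \<Sum>i<n. f i n x)" for n
  have "g \<in> covers (\<Union>i. A i)"
    unfolding covers_def
  proof (intro CollectI conjI allI ballI)
    show "continuous_on UNIV (g n)" for n
      unfolding g_def by (intro continuous_intros cf)
    show "0 \<le> g n x" for n x
      unfolding g_def by (intro sum_nonneg pf)
    show "incseq (\<lambda>n. g n x)" for x
      unfolding incseq_def
    proof (intro allI impI)
      fix m n :: nat assume "m \<le> n"
      have "g m x \<le> (\<Sum>i<m. f i n x)"
        unfolding g_def by (intro sum_mono mf \<open>m \<le> n\<close>)
      also have "\<dots> \<le> g n x"
        unfolding g_def using \<open>m \<le> n\<close> by (intro sum_mono2) (auto simp: pf)
      finally show "g m x \<le> g n x" .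
    qed
    fix x assume "x \<in> (\<Union>i. A i)"
    then obtain i where "x \<in> A i" by auto
    then obtain m where m: "1 \<le> f i m x" using f[of i] by (auto simp: covers_def)
    define n where "n = max m (Suc i)"
    have "1 \<le> f i n x" using m mf[of m n i x] by (simp add: n_def)
    also have "\<dots> \<le> g n x"
      unfolding g_def by (intro member_le_sum) (auto simp: pf n_def)
    finally show "\<exists>n. 1 \<le> g n x" ..
  qed
  then have "outer (\<Union>i. A i) \<le> (\<Sum>i. SUP n. ennreal (L (f i n)))"
  proof (rule outer_le)
    fix n
    have "ennreal (L (g n)) = ennreal (\<Sum>i<n. L (f i n))"
      unfolding g_def by (simp add: L_sum cf)
    also have "\<dots> = (\<Sum>i<n. ennreal (L (f i n)))"
      by (intro sum_ennreal[symmetric] L_nonneg cf pf)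
    also have "\<dots> \<le> (\<Sum>i<n. SUP n. ennreal (L (f i n)))"
      by (intro sum_mono SUP_upper) auto
    also have "\<dots> \<le> (\<Sum>i. SUP n. ennreal (L (f i n)))"
      by (intro sum_le_suminf) auto
    finally show "ennreal (L (g n)) \<le> (\<Sum>i. SUP n. ennreal (L (f i n)))" .
  qed
  also have "\<dots> \<le> (\<Sum>n. outer (A n) + ennreal e * ennreal ((1/2) ^ Suc n))"
    using fl \<open>0 < e\<close> by (intro suminf_le) (auto simp: ennreal_mult[symmetric] less_imp_le)
  also have "\<dots> = (\<Sum>n. outer (A n)) + (\<Sum>n. ennreal e * ennreal ((1/2) ^ Suc n))"
    by (subst suminf_add[symmetric]) (auto simp del: ennreal_suminf_cmult)
  also have "\<dots> = (\<Sum>n. outer (A n)) + e"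
    unfolding ennreal_suminf_cmult
    by (subst suminf_ennreal_eq[OF zero_le_power power_half_series]) auto
  finally show "outer (\<Union>i. A i) \<le> (\<Sum>n. outer (A n)) + e" .
qed

lemma outer_measure_space_outer: "outer_measure_space UNIV outer"
  by (auto simp: outer_measure_space_def positive_def increasing_def countably_subadditive_def
      outer_empty outer_mono outer_UN_le)

text \<open>Multiplying a cover of \<open>B\<close> by \<open>h\<^sub>n = min 1 (n d(-, A))\<close> yields a cover of
  \<open>B - A\<close>, while multiplying it by \<open>1 - h\<^sub>k\<close> for a fixed \<open>k\<close> yields one of \<open>A \<inter> B\<close>.\<close>

lemma closed_Caratheodory:
  assumes "closed A"
  shows "outer (A \<inter> B) + outer (B - A) = outer B"
\<comment> \<open>By convention \<open>infdist x {} = 0\<close>, so the cut-offs below would vanish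
  identically; empty \<open>A\<close> is treated apart.\<close>
proof (cases "A = {}")
  case False
  interpret P: sigma_algebra "UNIV :: 'a set" UNIV
    using sigma_algebra_Pow[of "UNIV :: 'a set"] by simp
  have "subadditive UNIV outer"
    using outer_measure_space_outer P.countably_subadditive_subadditive
    by (auto simp: outer_measure_space_def)
  then have "outer ((A \<inter> B) \<union> (B - A)) \<le> outer (A \<inter> B) + outer (B - A)"
    by (rule subadditiveD) auto
  moreover have "(A \<inter> B) \<union> (B - A) = B" by auto
  moreover have "outer (A \<inter> B) + outer (B - A) \<le> outer B"
    unfolding outer_def[of B]
  proof (rule INF_greatest)
    fix f assume f: "f \<in> covers B"
    then have cf: "continuous_on UNIV (f n)" and pf: "0 \<le> f n x"
      and ex: "y \<in> B \<Longrightarrow> \<exists>n. 1 \<le> f n y" for n x y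
      by (auto simp: covers_def)
    have mf: "f m x \<le> f n x" if "m \<le> n" for m n x
      using f that by (auto simp: covers_def incseq_def)
    define h where "h k x = min 1 (real k * infdist x A)" for k x
    have ch: "continuous_on UNIV (h k)" for k
      unfolding h_def by (intro continuous_intros)
    have h01: "0 \<le> h k x" "h k x \<le> 1" for k x
      by (auto simp: h_def infdist_nonneg)
    have mh: "h j x \<le> h k x" if "j \<le> k" for j k x
      unfolding h_def using that by (intro min.mono mult_right_mono) (auto simp: infdist_nonneg)
    let ?g = "\<lambda>n x. f n x * h n x"
    let ?k = "\<lambda>k n x. f n x * (1 - h k x)"
    have g: "?g \<in> covers (B - A)"
      unfolding covers_def
    proof (intro CollectI conjI allI ballI)
      show "continuous_on UNIV (?g n)" for n by (intro continuous_intros cf ch)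
      show "0 \<le> ?g n x" for n x by (simp add: pf h01)
      show "incseq (\<lambda>n. ?g n x)" for x
        by (auto simp: incseq_def intro!: mult_mono mf mh pf h01)
      fix x assume x: "x \<in> B - A"
      then obtain m where m: "1 \<le> f m x" using ex by auto
      have "0 < infdist x A"
        using x assms False infdist_pos_not_in_closed by blast
      then obtain k where "1 < real k * infdist x A"
        using reals_Archimedean3 by blast
      then have k: "h k x = 1" by (simp add: h_def)
      have "1 * 1 \<le> f (max m k) x * h (max m k) x"
        using m k mf[of m "max m k" x] mh[of k "max m k" x] by (intro mult_mono) auto
      then show "\<exists>n. 1 \<le> ?g n x" by auto
    qed
    have k: "?k k \<in> covers (A \<inter> B)" for k
      unfolding covers_def
    proof (intro CollectI conjI allI ballI)
      show "continuous_on UNIV (?k k n)" for n by (intro continuous_intros cf ch)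
      show "0 \<le> ?k k n x" for n x by (simp add: pf h01)
      show "incseq (\<lambda>n. ?k k n x)" for x
        by (auto simp: incseq_def intro!: mult_mono mf pf h01)
      show "\<exists>n. 1 \<le> ?k k n x" if "x \<in> A \<inter> B" for x
        using that ex[of x] by (simp add: h_def)
    qed
    \<comment> \<open>The index \<open>j\<close> of the cover of \<open>B - A\<close> is fixed first
      and then reused as the cut-off for \<open>A \<inter> B\<close>, so the two suprema are treated
      one after the other.\<close>
    have "outer (A \<inter> B) + outer (B - A) \<le> outer (A \<inter> B) + (SUP j. ennreal (L (?g j)))"
      by (intro add_left_mono outer_le[OF g] SUP_upper) auto
    also have "\<dots> = (SUP j. outer (A \<inter> B) + ennreal (L (?g j)))"
      by (rule ennreal_SUP_add_right) auto
    also have "\<dots> \<le> (SUP n. ennreal (L (f n)))"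
    proof (rule SUP_least)
      fix j
      have "outer (A \<inter> B) + ennreal (L (?g j))
          \<le> (SUP n. ennreal (L (?k j n))) + ennreal (L (?g j))"
        by (intro add_right_mono outer_le[OF k[of j]] SUP_upper) auto
      also have "\<dots> = (SUP n. ennreal (L (?k j n)) + ennreal (L (?g j)))"
        by (rule ennreal_SUP_add_left[symmetric]) auto
      also have "\<dots> \<le> (SUP n. ennreal (L (f n)))"
      proof (rule SUP_least)
        fix n
        \<comment> \<open>At the common later index \<open>N\<close> the products are at most
          \<open>f N x * (1 - h j x)\<close> and \<open>f N x * h j x\<close>, which add up to
          \<open>f N x\<close>.\<close>
        define N where "N = max n j"
        have "ennreal (L (?k j n)) + ennreal (L (?g j))
            = ennreal (L (?k j n) + L (?g j))"
          by (intro ennreal_plus[symmetric] L_nonneg continuous_intros cf ch) (auto simp: pf h01)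
        also have "\<dots> = ennreal (L (\<lambda>x. ?k j n x + ?g j x))"
          by (subst L_add) (auto intro!: continuous_intros cf ch)
        also have "\<dots> \<le> ennreal (L (f N))"
        proof (intro ennreal_leI L_mono)
          fix x
          have "?k j n x + ?g j x \<le> ?k j N x + f N x * h j x"
            by (intro add_mono mult_right_mono mf) (auto simp: h01 N_def)
          then show "?k j n x + ?g j x \<le> f N x" by (simp add: algebra_simps)
        qed (auto intro!: continuous_intros cf ch)
        also have "\<dots> \<le> (SUP n. ennreal (L (f n)))" by (rule SUP_upper) auto
        finally show "ennreal (L (?k j n)) + ennreal (L (?g j)) \<le> (SUP n. ennreal (L (f n)))" .
      qed
      finally show "outer (A \<inter> B) + ennreal (L (?g j)) \<le> (SUP n. ennreal (L (f n)))" .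
    qed
    finally show "outer (A \<inter> B) + outer (B - A) \<le> (SUP n. ennreal (L (f n)))" .
  qed
  ultimately show ?thesis by simp
qed (simp add: outer_empty)

section \<open>Caratheodory's construction of the measure\<close>

definition representing :: "'a measure" where
  "representing = measure_of UNIV (sets borel) outer"

lemma sets_representing [simp]: "sets representing = sets borel"
  unfolding representing_def using sets.sigma_sets_eq[of "borel :: 'a measure"] by simp

lemma space_representing [simp]: "space representing = UNIV"
  unfolding representing_def by simp

text \<open>Closed sets split every set additively, so the Caratheodory sigma-algebra
  \<open>ls\<close>, on which \<open>outer\<close> is a measure, contains the Borel sets.\<close>

lemma emeasure_representing:
  assumes "A \<in> sets borel" shows "emeasure representing A = outer A"
proof -
  interpret P: sigma_algebra "UNIV :: 'a set" UNIV
    using sigma_algebra_Pow[of "UNIV :: 'a set"] by simp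
  define ls where "ls = lambda_system UNIV UNIV outer"
  have ms: "measure_space UNIV ls outer"
    unfolding ls_def by (rule P.caratheodory_lemma[OF outer_measure_space_outer])
  have "A \<in> ls" if "closed A" for A
    using closed_Caratheodory[OF that]
    by (auto simp: ls_def lambda_system_def Diff_eq Int_commute)
  then have "sigma_sets UNIV (Collect closed) \<subseteq> ls"
    using ms by (intro sigma_algebra.sigma_sets_subset) (auto simp: measure_space_def)
  then have sub: "sets borel \<subseteq> ls"
    by (simp add: borel_eq_closed)
  have "sigma_algebra UNIV (sets (borel :: 'a measure))"
    using sets.sigma_algebra_axioms[of "borel :: 'a measure"] by simp
  with measure_down[OF ms this sub] assms show ?thesis
    unfolding representing_def measure_space_def
    by (intro emeasure_measure_of_sigma) auto
qed

text \<open>The lower bound is a Dini argument: for \<open>r < 1\<close> the increasing open sets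
  where \<open>f n\<close> exceeds \<open>r\<close> cover the compact space, so a single
  \<open>f N\<close> is at least \<open>r\<close> everywhere.\<close>

lemma outer_UNIV: "outer UNIV = 1"
proof (rule antisym)
  show "outer UNIV \<le> 1"
    using outer_le_functional[of "\<lambda>x. 1" UNIV] by (simp add: L_one)
  show "1 \<le> outer UNIV"
    unfolding outer_def
  proof (rule INF_greatest)
    fix f assume f: "f \<in> covers UNIV"
    then have cf: "continuous_on UNIV (f n)" and pf: "0 \<le> f n x" and ex: "\<exists>n. 1 \<le> f n y"
      for n x y by (auto simp: covers_def)
    have mf: "f m x \<le> f n x" if "m \<le> n" for m n x
      using f that by (auto simp: covers_def incseq_def)
    show "1 \<le> (SUP n. ennreal (L (f n)))"
    proof (rule dense_le)
      fix y :: ennreal assume "y < 1"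
      then obtain r where r: "y = ennreal r" "0 \<le> r" "r < 1"
        by (cases y) auto
      have op: "open {x. r < f n x}" for n
        by (intro open_Collect_less cf continuous_intros)
      have "UNIV \<subseteq> (\<Union>n\<in>UNIV. {x. r < f n x})"
      proof
        fix x
        obtain n where "1 \<le> f n x" using ex by auto
        then show "x \<in> (\<Union>n\<in>UNIV. {x. r < f n x})" using r by (intro UN_I[of n]) auto
      qed
      then obtain C where C: "finite C" "UNIV \<subseteq> (\<Union>n\<in>C. {x. r < f n x})"
        using compactE_image[OF compact_UNIV, of UNIV "\<lambda>n. {x. r < f n x}"] op by metis
      obtain N where N: "\<And>n. n \<in> C \<Longrightarrow> n \<le> N"
        using finite_nat_set_iff_bounded_le C(1) by auto
      have "r \<le> f N x" for x
      proof -
        obtain n where "n \<in> C" "r < f n x" using C(2) by auto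
        with mf[of n N x] N show ?thesis by fastforce
      qed
      then have "L (\<lambda>x. r) \<le> L (f N)" by (intro L_mono cf) auto
      then have "y \<le> ennreal (L (f N))" by (simp add: r L_const ennreal_leI)
      also have "\<dots> \<le> (SUP n. ennreal (L (f n)))" by (rule SUP_upper) auto
      finally show "y \<le> (SUP n. ennreal (L (f n)))" .
    qed
  qed
qed

lemma prob_space_representing: "prob_space representing"
  by (rule prob_spaceI) (simp add: emeasure_representing outer_UNIV)

lemma measure_representing_le:
  assumes "A \<in> sets borel" "continuous_on UNIV g" "\<And>x. 0 \<le> g x" "\<And>x. x \<in> A \<Longrightarrow> 1 \<le> g x"
  shows "measure representing A \<le> L g"
  unfolding measure_def emeasure_representing[OF assms(1)]
  using outer_le_functional[OF assms(2-4)] L_nonneg[OF assms(2,3)]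
  by (intro enn2real_leI) auto

section \<open>Integrals of continuous functions against the representing measure\<close>

lemma integrable_representing:
  fixes f :: "'a \<Rightarrow> real"
  assumes "continuous_on UNIV f"
  shows "integrable representing f"
proof -
  interpret prob_space representing by (rule prob_space_representing)
  have "bounded (range f)"
    by (intro compact_imp_bounded compact_continuous_image assms compact_UNIV)
  then obtain B where "\<And>x. norm (f x) \<le> B" by (auto simp: bounded_iff)
  moreover have "f \<in> borel_measurable representing"
    using borel_measurable_continuous_onI[OF assms] by (simp cong: measurable_cong_sets)
  ultimately show ?thesis by (intro integrable_const_bound[of _ B]) auto
qed

text \<open>A layer-cake argument: \<open>real N * f\<close> is cut into \<open>N\<close> slices
  \<open>g i\<close> of height at most 1, and the integral of each slice is compared with
  \<open>L\<close> of the slice below it. The bottom slice costs at most 1, hence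
  \<open>1 / N\<close> after division.\<close>

lemma integral_representing_le01:
  assumes cf: "continuous_on UNIV f" and f01: "\<And>x. 0 \<le> f x" "\<And>x. f x \<le> 1"
  shows "integral\<^sup>L representing f \<le> L f"
proof (rule field_le_epsilon)
  interpret prob_space representing by (rule prob_space_representing)
  fix e :: real assume "0 < e"
  then obtain N where N: "0 < N" "1 / real N < e"
    using nat_approx_posE by (metis zero_less_Suc of_nat_Suc)
  define g where "g i x = max 0 (min 1 (real N * f x - real i))" for i x
  have cg: "continuous_on UNIV (g i)" for i
    unfolding g_def by (intro continuous_intros cf)
  have g01: "0 \<le> g i x" "g i x \<le> 1" for i x by (auto simp: g_def)
  have sg: "(\<Sum>i<n. g i x) = min (real n) (real N * f x)" for n x
    by (induction n) (use f01(1)[of x] in \<open>auto simp: g_def min_def max_def\<close>)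
  have sgN: "(\<Sum>i<N. g i x) = real N * f x" for x
    using f01(2)[of x] N by (simp add: sg min_def mult_le_cancel_left1)
  have Lg: "(\<Sum>i<N. L (g i)) = real N * L f"
    using L_sum[of "{..<N}" g] cg L_scale[OF cf, of "real N"] by (simp add: sgN)
  \<comment> \<open>On the set where \<open>real N * f x\<close> reaches \<open>Suc i\<close> the
    slice \<open>g i\<close> is 1, and off it \<open>g (Suc i)\<close> is 0; the measure of this set
    separates the two sides.\<close>
  have step: "integral\<^sup>L representing (g (Suc i)) \<le> L (g i)" for i
  proof -
    let ?A = "{x. real (Suc i) \<le> real N * f x}"
    have A: "?A \<in> sets borel"
      by (intro borel_closed closed_Collect_le continuous_intros cf)
    have "integral\<^sup>L representing (g (Suc i)) \<le> integral\<^sup>L representing (indicator ?A)"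
    proof (rule integral_mono)
      show "integrable representing (indicator ?A :: 'a \<Rightarrow> real)"
        using A by (intro integrable_real_indicator) (auto simp: emeasure_eq_measure)
      show "integrable representing (g (Suc i))" by (rule integrable_representing[OF cg])
    qed (auto simp: g_def indicator_def)
    also have "\<dots> = measure representing ?A" using A by simp
    also have "\<dots> \<le> L (g i)"
      by (intro measure_representing_le A cg g01) (auto simp: g_def)
    finally show ?thesis .
  qed
  obtain M where M: "N = Suc M" using N(1) by (cases N) auto
  have "real N * integral\<^sup>L representing f = integral\<^sup>L representing (\<lambda>x. \<Sum>i<N. g i x)"
    by (simp add: sgN)
  also have "\<dots> = (\<Sum>i<N. integral\<^sup>L representing (g i))"
    by (intro Bochner_Integration.integral_sum integrable_representing cg)
  also have "\<dots> = integral\<^sup>L representing (g 0) + (\<Sum>i<M. integral\<^sup>L representing (g (Suc i)))"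
    unfolding M by (rule sum.lessThan_Suc_shift)
  also have "\<dots> \<le> 1 + (\<Sum>i<M. L (g i))"
  proof (intro add_mono sum_mono step)
    have "integral\<^sup>L representing (g 0) \<le> integral\<^sup>L representing (\<lambda>x. 1)"
      by (intro integral_mono integrable_representing cg g01) auto
    then show "integral\<^sup>L representing (g 0) \<le> 1" using prob_space by simp
  qed
  also have "\<dots> \<le> 1 + (\<Sum>i<N. L (g i))"
    unfolding M by (simp add: L_nonneg cg g01)
  finally have "real N * integral\<^sup>L representing f \<le> 1 + real N * L f" by (simp add: Lg)
  then have "integral\<^sup>L representing f \<le> 1 / real N + L f"
    using N(1) by (simp add: field_simps)
  then show "integral\<^sup>L representing f \<le> L f + e" using N(2) by simp
qed

lemma integral_representing_le:
  assumes cf: "continuous_on UNIV f"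
  shows "integral\<^sup>L representing f \<le> L f"
proof -
  interpret prob_space representing by (rule prob_space_representing)
  have "bounded (range f)"
    by (intro compact_imp_bounded compact_continuous_image assms compact_UNIV)
  then obtain B where B: "0 < B" "\<And>x. norm (f x) \<le> B" by (auto simp: bounded_pos)
  \<comment> \<open>An affine change maps the range, contained in [-B, B], into [0, 1].\<close>
  define g where "g x = 1 / (2 * B) * (f x + B)" for x
  have "integral\<^sup>L representing g \<le> L g"
  proof (rule integral_representing_le01)
    show "continuous_on UNIV g" unfolding g_def by (intro continuous_intros cf)
    show "0 \<le> g x" "g x \<le> 1" for x
      using B(1) B(2)[of x] by (auto simp: g_def field_simps)
  qed
  moreover have "L g = 1 / (2 * B) * (L f + B)"
    unfolding g_def using L_scale[of "\<lambda>x. f x + B" "1 / (2 * B)"] L_add[OF cf, of "\<lambda>x. B"]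
    using continuous_on_add[OF cf continuous_on_const[of UNIV B]] by (simp add: L_const)
  moreover have "integral\<^sup>L representing g = 1 / (2 * B) * (integral\<^sup>L representing f + B)"
    unfolding g_def using integrable_representing[OF cf] prob_space by simp
  ultimately show ?thesis using B(1) by (simp add: field_simps)
qed

lemma integral_representing:
  assumes "continuous_on UNIV f"
  shows "integral\<^sup>L representing f = L f"
  using integral_representing_le[OF assms] integral_representing_le[of "\<lambda>x. - f x"]
    L_scale[OF assms, of "-1"] continuous_on_minus[OF assms]
  by simp

end

section \<open>Continuous functions determine a Borel probability measure\<close>

text \<open>\<open>A\<close> is nonempty because \<open>infdist x {} = 0\<close> would make every
  approximant constantly 1.\<close>

lemma closed_indicator_approx:
  fixes A :: "'a::metric_space set"
  assumes "closed A" "A \<noteq> {}"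
  shows "(\<lambda>k. max 0 (1 - real k * infdist x A)) \<longlonglongrightarrow> indicator A x"
proof (cases "x \<in> A")
  case False
  then have pos: "0 < infdist x A" using assms infdist_pos_not_in_closed by blast
  then obtain K :: nat where K: "1 < real K * infdist x A" using reals_Archimedean3 by blast
  have "max 0 (1 - real k * infdist x A) = 0" if "k \<ge> K" for k
  proof -
    have "real K * infdist x A \<le> real k * infdist x A" using that pos by simp
    then show ?thesis using K by simp
  qed
  then show ?thesis
    using False by (intro tendsto_eventually) (auto simp: eventually_sequentially)
qed simp

text \<open>Closed sets form an intersection-stable generator of the Borel sets, and dominated
  convergence carries the equality from continuous functions to their indicators.\<close>

lemma borel_prob_eqI:
  fixes \<mu> \<nu> :: "'a::metric_space measure"
  assumes \<mu>: "borel_prob \<mu>" and \<nu>: "borel_prob \<nu>"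
    and eq: "\<And>f :: 'a \<Rightarrow> real. continuous_on UNIV f \<Longrightarrow> integral\<^sup>L \<mu> f = integral\<^sup>L \<nu> f"
  shows "\<mu> = \<nu>"
proof (rule measure_eqI_generator_eq[of "Collect closed" UNIV \<mu> \<nu> "\<lambda>_. UNIV"])
  interpret m: prob_space \<mu> using \<mu> by (simp add: borel_prob_def)
  interpret n: prob_space \<nu> using \<nu> by (simp add: borel_prob_def)
  have s: "sets \<mu> = sets borel" "sets \<nu> = sets borel"
    using \<mu> \<nu> by (auto simp: borel_prob_def)
  have sp: "space \<mu> = UNIV" "space \<nu> = UNIV"
    using s by (auto dest: sets_eq_imp_space_eq)
  show "sets \<mu> = sigma_sets UNIV (Collect closed)" "sets \<nu> = sigma_sets UNIV (Collect closed)"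
    using s by (auto simp: borel_eq_closed)
  show "emeasure \<mu> UNIV \<noteq> \<infinity>" using m.emeasure_finite by auto
  show "emeasure \<mu> A = emeasure \<nu> A" if "A \<in> Collect closed" for A
  proof (cases "A = {}")
    case False
    from that have A: "closed A" by simp
    define h where "h k x = max 0 (1 - real k * infdist x A)" for k x
    have ch: "continuous_on UNIV (h k)" for k
      unfolding h_def by (intro continuous_intros)
    have mh: "h k \<in> borel_measurable M" if "sets M = sets borel" for k and M :: "'a measure"
      using borel_measurable_continuous_onI[OF ch] that by (simp cong: measurable_cong_sets)
    have lim: "(\<lambda>k. integral\<^sup>L M (h k)) \<longlonglongrightarrow> integral\<^sup>L M (indicator A)"
      if "prob_space M" "sets M = sets borel" for M :: "'a measure"
    proof (rule integral_dominated_convergence[where w = "\<lambda>_. 1"])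
      interpret prob_space M by fact
      show "integrable M (\<lambda>_. 1 :: real)" by simp
      show "indicator A \<in> borel_measurable M"
        using A by (intro borel_measurable_indicator) (simp add: that)
      show "AE x in M. (\<lambda>k. h k x) \<longlonglongrightarrow> indicator A x"
        unfolding h_def using closed_indicator_approx[OF A False] by simp
      show "AE x in M. norm (h k x) \<le> 1" for k
        by (auto simp: h_def infdist_nonneg)
    qed (use mh that in auto)
    have "(\<lambda>k. integral\<^sup>L \<mu> (h k)) \<longlonglongrightarrow> integral\<^sup>L \<nu> (indicator A)"
      unfolding eq[OF ch] by (rule lim[OF n.prob_space_axioms s(2)])
    from LIMSEQ_unique[OF lim[OF m.prob_space_axioms s(1)] this]
    have "measure \<mu> A = measure \<nu> A" by (simp add: sp)
    then show ?thesis by (simp add: m.emeasure_eq_measure n.emeasure_eq_measure)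
  qed simp
qed (auto simp: Int_stable_def)

section \<open>Averages along Feldman--Katok close sequences\<close>

lemma integral_empirical:
  fixes f :: "'a::topological_space \<Rightarrow> real"
  assumes "continuous_on UNIV f"
  shows "integral\<^sup>L (empirical x n) f = (\<Sum>j<n. f (x j)) / real n"
proof -
  have "x \<in> measurable (uniform_count_measure {..<n}) borel"
    by (auto simp: measurable_def space_uniform_count_measure sets_uniform_count_measure)
  then show ?thesis
    using borel_measurable_continuous_onI[OF assms] unfolding empirical_def
    by (simp add: integral_distr integral_uniform_count_measure)
qed

lemma generic_seq_iff:
  "generic_seq x \<mu> \<longleftrightarrow> borel_prob \<mu> \<and> (\<forall>f::'a::topological_space \<Rightarrow> real. continuous_on UNIV f \<longrightarrow>
     (\<lambda>n. (\<Sum>j<n. f (x j)) / real n) \<longlonglongrightarrow> integral\<^sup>L \<mu> f)"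
  unfolding generic_seq_def weak_star_lim_def by (auto simp: integral_empirical)

text \<open>One \<open>\<delta>\<close> bounds both the distance of matched points and the
  proportion of unmatched indices, as in \<open>fk\<close>. A witness at a finite time spares later
  estimates the maximum, the limit superior and the infimum.\<close>

definition close_upto ::
  "nat \<Rightarrow> real \<Rightarrow> (nat \<Rightarrow> 'a::metric_space) \<Rightarrow> (nat \<Rightarrow> 'a) \<Rightarrow> bool" where
  "close_upto n \<delta> x z \<longleftrightarrow>
     (\<exists>D R \<pi>. fk_match n \<delta> x z D R \<pi> \<and> (1 - \<delta>) * real n \<le> real (card D))"

lemma fk_match_mono: "fk_match n \<delta> x z D R \<pi> \<Longrightarrow> \<delta> \<le> \<delta>' \<Longrightarrow> fk_match n \<delta>' x z D R \<pi>"
  by (fastforce simp: fk_match_def)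

lemma close_upto_mono:
  assumes "close_upto n \<delta> x z" "\<delta> \<le> \<delta>'" shows "close_upto n \<delta>' x z"
proof -
  obtain D R \<pi> where m: "fk_match n \<delta> x z D R \<pi>" "(1 - \<delta>) * real n \<le> real (card D)"
    using assms(1) by (auto simp: close_upto_def)
  have "(1 - \<delta>') * real n \<le> (1 - \<delta>) * real n"
    using assms(2) by (intro mult_right_mono) auto
  with m fk_match_mono[OF m(1) assms(2)] show ?thesis
    unfolding close_upto_def by (meson order_trans)
qed

lemma finite_match_sizes: "finite {card D | D R \<pi>. fk_match n \<delta> x z D R \<pi>}"
  by (rule finite_subset[of _ "{..n}"])
    (auto simp: fk_match_def dest!: card_mono[OF finite_lessThan])

lemma zero_match_size: "0 \<in> {card D | D R \<pi>. fk_match n \<delta> x z D R \<pi>}"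
  by (rule CollectI, rule exI[of _ "{}"], rule exI[of _ "{}"]) (auto simp: fk_match_def)

text \<open>The tolerance grows to \<open>\<delta>'\<close> while the bound remains
  \<open>\<delta>\<close>, because \<open>fk\<close> asks for a value strictly below the tolerance.
  At \<open>n = 0\<close> division by zero gives \<open>fbar_upto\<close> the value 1.\<close>

lemma fbar_upto_le:
  assumes "close_upto n \<delta> x z" "\<delta> \<le> \<delta>'" "0 < n"
  shows "fbar_upto n \<delta>' x z \<le> \<delta>"
proof -
  obtain D R \<pi> where m: "fk_match n \<delta> x z D R \<pi>" "(1 - \<delta>) * real n \<le> real (card D)"
    using assms(1) by (auto simp: close_upto_def)
  have "card D \<le> Max {card D | D R \<pi>. fk_match n \<delta>' x z D R \<pi>}"
    using fk_match_mono[OF m(1) assms(2)] by (intro Max_ge finite_match_sizes) auto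
  then have "(1 - \<delta>) * real n \<le> real (Max {card D | D R \<pi>. fk_match n \<delta>' x z D R \<pi>})"
    using m(2) by (meson of_nat_mono order_trans)
  then show ?thesis
    using assms(3) by (simp add: fbar_upto_def field_simps)
qed

lemma close_upto_if_fbar_upto_less:
  assumes "fbar_upto n \<delta> x z < \<delta>" "0 < n"
  shows "close_upto n \<delta> x z"
proof -
  \<comment> \<open>The maximum is attained: the set of sizes is finite and contains 0, the size of
    the empty match.\<close>
  have "Max {card D | D R \<pi>. fk_match n \<delta> x z D R \<pi>} \<in> {card D | D R \<pi>. fk_match n \<delta> x z D R \<pi>}"
    by (rule Max_in[OF finite_match_sizes ex_in_conv[THEN iffD1, OF exI, OF zero_match_size]])
  then obtain D R \<pi> where "fk_match n \<delta> x z D R \<pi>"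
    and "Max {card D | D R \<pi>. fk_match n \<delta> x z D R \<pi>} = card D" by auto
  then show ?thesis
    using assms unfolding close_upto_def fbar_upto_def
    by (intro exI[of _ D] exI[of _ R] exI[of _ \<pi>]) (simp add: field_simps)
qed

lemma fbar_le_one: "fbar \<delta> x z \<le> 1"
  unfolding fbar_def by (rule Limsup_bounded) (simp add: fbar_upto_def)

lemma fk_set_nonempty: "{\<delta>. 0 < \<delta> \<and> fbar \<delta> x z < ereal \<delta>} \<noteq> {}"
proof -
  have "fbar 2 x z < ereal 2"
    using fbar_le_one[of 2 x z] by (rule le_less_trans) simp
  then show "{\<delta>. 0 < \<delta> \<and> fbar \<delta> x z < ereal \<delta>} \<noteq> {}" by force
qed

text \<open>Some \<open>\<delta>' < \<delta>\<close> lies in the set defining the infimum; a limit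
  superior strictly below \<open>\<delta>'\<close> bounds almost all terms, and enlarging the
  tolerance is harmless.\<close>

lemma eventually_close_upto:
  assumes "fk x z < \<delta>"
  shows "\<forall>\<^sub>F n in sequentially. close_upto n \<delta> x z"
proof -
  from cInf_lessD[OF fk_set_nonempty assms[unfolded fk_def]]
  obtain \<delta>' where \<delta>': "fbar \<delta>' x z < ereal \<delta>'" "\<delta>' < \<delta>" by auto
  from Limsup_lessD[OF \<delta>'(1)[unfolded fbar_def]] eventually_gt_at_top[of 0]
  show ?thesis
    by eventually_elim
      (use \<delta>'(2) in \<open>auto intro: close_upto_mono close_upto_if_fbar_upto_less\<close>)
qed

text \<open>Every \<open>\<delta>' > \<delta>\<close> lies in the set defining the infimum, as its
  limit superior is at most \<open>\<delta>\<close>.\<close>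

lemma fk_le:
  assumes "0 < \<delta>" "\<forall>\<^sub>F n in sequentially. close_upto n \<delta> x z"
  shows "fk x z \<le> \<delta>"
proof (rule dense_ge)
  fix \<delta>' assume "\<delta> < \<delta>'"
  have "\<forall>\<^sub>F n in sequentially. ereal (fbar_upto n \<delta>' x z) \<le> ereal \<delta>"
    using assms(2) eventually_gt_at_top[of 0]
    by eventually_elim (use \<open>\<delta> < \<delta>'\<close> in \<open>auto intro: fbar_upto_le\<close>)
  then have "fbar \<delta>' x z \<le> ereal \<delta>"
    unfolding fbar_def by (rule Limsup_bounded)
  also have "\<dots> < ereal \<delta>'" using \<open>\<delta> < \<delta>'\<close> by simp
  finally show "fk x z \<le> \<delta>'"
    unfolding fk_def using assms(1) \<open>\<delta> < \<delta>'\<close>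
    by (intro cInf_lower) (auto intro!: bdd_belowI[of _ 0])
qed

lemma fk_nonneg: "0 \<le> fk x z"
  unfolding fk_def by (intro cInf_greatest fk_set_nonempty) auto

text \<open>\<open>\<delta>\<close> depends on \<open>f\<close> and \<open>e\<close> alone, so the
  estimate is uniform in \<open>n\<close> and in both sequences. Matched pairs contribute at most
  \<open>e / 2\<close> by uniform continuity, unmatched indices at most \<open>e / 2\<close> by
  boundedness.\<close>

lemma close_upto_sum_diff:
  fixes f :: "'a::metric_space \<Rightarrow> real"
  assumes c: "compact (UNIV :: 'a set)" and cf: "continuous_on UNIV f" and "0 < e"
  obtains \<delta> where "0 < \<delta>" "\<And>n x z. close_upto n \<delta> x z \<Longrightarrow>
    \<bar>(\<Sum>j<n. f (x j)) / real n - (\<Sum>j<n. f (z j)) / real n\<bar> \<le> e"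
proof -
  have "bounded (range f)"
    by (intro compact_imp_bounded compact_continuous_image cf c)
  then obtain B where B: "0 < B" "\<And>x. \<bar>f x\<bar> \<le> B" by (auto simp: bounded_pos)
  have "uniformly_continuous_on UNIV f"
    by (intro compact_uniformly_continuous cf c)
  then obtain d where d: "0 < d" "\<And>x y. dist x y < d \<Longrightarrow> \<bar>f x - f y\<bar> < e / 2"
    using \<open>0 < e\<close> unfolding uniformly_continuous_on_def dist_real_def
    by (metis UNIV_I dist_commute half_gt_zero)
  \<comment> \<open>At most \<open>\<delta> * n\<close> indices are unmatched on each side, each
    contributing at most \<open>B\<close>, in total at most \<open>e / 2 * n\<close>.\<close>
  define \<delta> where "\<delta> = min d (e / (4 * B))"
  have "\<bar>(\<Sum>j<n. f (x j)) / real n - (\<Sum>j<n. f (z j)) / real n\<bar> \<le> e"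
    if "close_upto n \<delta> x z" for n x z
  proof (cases "n = 0")
    case False
    obtain D R \<pi> where m: "fk_match n \<delta> x z D R \<pi>" and cD: "(1 - \<delta>) * real n \<le> real (card D)"
      using \<open>close_upto n \<delta> x z\<close> by (auto simp: close_upto_def)
    have D: "D \<subseteq> {..<n}" and R: "R \<subseteq> {..<n}" and b: "bij_betw \<pi> D R"
      and dd: "\<And>i. i \<in> D \<Longrightarrow> dist (x i) (z (\<pi> i)) < d"
      using m by (auto simp: fk_match_def \<delta>_def)
    have fin: "finite D" "finite R" using D R by (auto intro: finite_subset)
    have card: "card R = card D" "card D \<le> n"
      using bij_betw_same_card[OF b] card_mono[OF _ D] by auto
    have x: "(\<Sum>j<n. f (x j)) = (\<Sum>i\<in>D. f (x i)) + (\<Sum>i\<in>{..<n} - D. f (x i))"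
      using sum.subset_diff[OF D, of "\<lambda>j. f (x j)"] by simp
    have z: "(\<Sum>j<n. f (z j)) = (\<Sum>i\<in>D. f (z (\<pi> i))) + (\<Sum>i\<in>{..<n} - R. f (z i))"
      using sum.subset_diff[OF R, of "\<lambda>j. f (z j)"] sum.reindex_bij_betw[OF b, of "\<lambda>j. f (z j)"]
      by simp
    have rest: "\<bar>\<Sum>i\<in>{..<n} - E. f (w i)\<bar> \<le> (real n - real (card D)) * B"
      if "E \<subseteq> {..<n}" "card E = card D" for E and w :: "nat \<Rightarrow> 'a"
    proof -
      have "\<bar>\<Sum>i\<in>{..<n} - E. f (w i)\<bar> \<le> of_nat (card ({..<n} - E)) * B"
        by (intro order_trans[OF sum_abs] sum_bounded_above) (use B in auto)
      also have "card ({..<n} - E) = n - card D"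
        using that finite_subset[OF that(1)] by (simp add: card_Diff_subset)
      finally show ?thesis using card(2) by (simp add: of_nat_diff)
    qed
    have "\<bar>(\<Sum>i\<in>D. f (x i)) - (\<Sum>i\<in>D. f (z (\<pi> i)))\<bar> \<le> of_nat (card D) * (e / 2)"
      unfolding sum_subtractf[symmetric]
      by (intro order_trans[OF sum_abs] sum_bounded_above) (use d(2) dd in \<open>force simp: less_imp_le\<close>)
    also have "\<dots> \<le> real n * (e / 2)"
      using card(2) \<open>0 < e\<close> by (intro mult_right_mono) auto
    finally have "\<bar>(\<Sum>j<n. f (x j)) - (\<Sum>j<n. f (z j))\<bar>
        \<le> real n * (e / 2) + 2 * ((real n - real (card D)) * B)"
      using rest[OF D refl, of x] rest[OF R card(1), of z] unfolding x z by linarith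
    also have "\<dots> \<le> real n * (e / 2) + 2 * ((real n * (e / (4 * B))) * B)"
    proof -
      have "real n - real (card D) \<le> real n * \<delta>" using cD by (simp add: algebra_simps)
      also have "\<dots> \<le> real n * (e / (4 * B))" by (intro mult_left_mono) (auto simp: \<delta>_def)
      finally show ?thesis using B(1) by (intro add_left_mono mult_left_mono mult_right_mono) auto
    qed
    also have "\<dots> = e * real n" using B(1) by (simp add: field_simps)
    finally show ?thesis
      using False by (simp add: diff_divide_distrib[symmetric] divide_le_eq)
  qed (use \<open>0 < e\<close> in simp)
  moreover have "0 < \<delta>" using d(1) B(1) \<open>0 < e\<close> by (simp add: \<delta>_def)
  ultimately show ?thesis using that by blast
qed

text \<open>For each late \<open>k\<close> the two averages differ by at most \<open>e / 2\<close>
  at all late times, which survives the limit over \<open>n\<close>. The integrals of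
  \<open>\<mu>\<close> are thus determined by the \<open>\<nu> k\<close> alone.\<close>

lemma fk_tendsto_imp_integral_tendsto:
  fixes f :: "'a::metric_space \<Rightarrow> real"
  assumes c: "compact (UNIV :: 'a set)"
    and y: "\<And>k. generic_seq (y k) (\<nu> k)" and z: "generic_seq z \<mu>"
    and lim: "(\<lambda>k. fk (y k) z) \<longlonglongrightarrow> 0" and cf: "continuous_on UNIV f"
  shows "(\<lambda>k. integral\<^sup>L (\<nu> k) f) \<longlonglongrightarrow> integral\<^sup>L \<mu> f"
proof (rule LIMSEQ_I)
  fix e :: real assume "0 < e"
  then have "0 < e / 2" by simp
  from close_upto_sum_diff[OF c cf this] obtain \<delta> where \<delta>: "0 < \<delta>"
    "\<And>n x z. close_upto n \<delta> x z \<Longrightarrow>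
      \<bar>(\<Sum>j<n. f (x j)) / real n - (\<Sum>j<n. f (z j)) / real n\<bar> \<le> e / 2" by metis
  obtain K where K: "\<And>k. k \<ge> K \<Longrightarrow> fk (y k) z < \<delta>"
    using order_tendstoD(2)[OF lim \<delta>(1)] by (auto simp: eventually_sequentially)
  have "\<bar>integral\<^sup>L (\<nu> k) f - integral\<^sup>L \<mu> f\<bar> \<le> e / 2" if "k \<ge> K" for k
  proof (rule tendsto_upperbound)
    show "(\<lambda>n. \<bar>(\<Sum>j<n. f (y k j)) / real n - (\<Sum>j<n. f (z j)) / real n\<bar>)
        \<longlonglongrightarrow> \<bar>integral\<^sup>L (\<nu> k) f - integral\<^sup>L \<mu> f\<bar>"
      using y[of k] z cf by (intro tendsto_intros) (auto simp: generic_seq_iff)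
    show "\<forall>\<^sub>F n in sequentially.
        \<bar>(\<Sum>j<n. f (y k j)) / real n - (\<Sum>j<n. f (z j)) / real n\<bar> \<le> e / 2"
      using eventually_close_upto[OF K[OF that]] by eventually_elim (rule \<delta>(2))
  qed simp
  then show "\<exists>K. \<forall>k\<ge>K. norm (integral\<^sup>L (\<nu> k) f - integral\<^sup>L \<mu> f) < e"
    using \<open>0 < e\<close> by (intro exI[of _ K]) (fastforce simp: real_norm_def)
qed

lemma fk_tendsto_imp_generic_seq:
  fixes z :: "nat \<Rightarrow> 'a::metric_space"
  assumes c: "compact (UNIV :: 'a set)"
    and y: "\<And>k. generic_seq (y k) (\<nu> k)" and lim: "(\<lambda>k. fk (y k) z) \<longlonglongrightarrow> 0"
  shows "\<exists>\<mu>. generic_seq z \<mu>"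
proof -
  define A where "A f n = (\<Sum>j<n. f (z j)) / real n" for f :: "'a \<Rightarrow> real" and n
  have "convergent (A f)" if cf: "continuous_on UNIV f" for f
  proof (rule Cauchy_convergent, rule metric_CauchyI)
    fix e :: real assume "0 < e"
    then have "0 < e / 4" by simp
    from close_upto_sum_diff[OF c cf this] obtain \<delta> where \<delta>: "0 < \<delta>"
      "\<And>n x z. close_upto n \<delta> x z \<Longrightarrow>
        \<bar>(\<Sum>j<n. f (x j)) / real n - (\<Sum>j<n. f (z j)) / real n\<bar> \<le> e / 4" by metis
    \<comment> \<open>One close \<open>y k\<close> suffices: its averages converge and those along
      \<open>z\<close> eventually stay within \<open>e / 4\<close> of them.\<close>
    obtain k where k: "fk (y k) z < \<delta>"
      using order_tendstoD(2)[OF lim \<delta>(1)] by (auto simp: eventually_sequentially)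
    let ?a = "\<lambda>n. (\<Sum>j<n. f (y k j)) / real n"
    have "Cauchy ?a"
      using y[of k] cf by (intro LIMSEQ_imp_Cauchy) (auto simp: generic_seq_iff)
    then obtain M where M: "\<And>m n. m \<ge> M \<Longrightarrow> n \<ge> M \<Longrightarrow> dist (?a m) (?a n) < e / 4"
      using metric_CauchyD \<open>0 < e / 4\<close> by blast
    obtain N where N: "\<And>n. n \<ge> N \<Longrightarrow> close_upto n \<delta> (y k) z"
      using eventually_close_upto[OF k] by (auto simp: eventually_sequentially)
    have "dist (A f m) (A f n) < e" if "m \<ge> max M N" "n \<ge> max M N" for m n
    proof -
      have "\<bar>?a m - A f m\<bar> \<le> e / 4" "\<bar>?a n - A f n\<bar> \<le> e / 4" "\<bar>?a m - ?a n\<bar> < e / 4"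
        using \<delta>(2)[OF N[of m]] \<delta>(2)[OF N[of n]] M[of m n] that
        by (simp_all add: A_def dist_real_def)
      then show ?thesis using \<open>0 < e\<close> unfolding dist_real_def by linarith
    qed
    then show "\<exists>M. \<forall>m\<ge>M. \<forall>n\<ge>M. dist (A f m) (A f n) < e" by blast
  qed
  then have A: "A f \<longlonglongrightarrow> lim (A f)" if "continuous_on UNIV f" for f
    using that convergent_LIMSEQ_iff by blast
  \<comment> \<open>At discontinuous \<open>f\<close> the limit may fail to exist and
    \<open>lim\<close> is then unspecified; the axioms only concern continuous functions.\<close>
  interpret mean_functional "\<lambda>f. lim (A f)"
  proof
    show "compact (UNIV :: 'a set)" by (rule c)
    show "lim (A (\<lambda>x. f x + g x)) = lim (A f) + lim (A g)"
      if "continuous_on UNIV f" "continuous_on UNIV g" for f g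
    proof (rule limI)
      have "A (\<lambda>x. f x + g x) = (\<lambda>n. A f n + A g n)"
        by (intro ext) (simp add: A_def sum.distrib add_divide_distrib)
      then show "A (\<lambda>x. f x + g x) \<longlonglongrightarrow> lim (A f) + lim (A g)"
        by (simp add: tendsto_add A that)
    qed
    show "lim (A (\<lambda>x. c * f x)) = c * lim (A f)" if "continuous_on UNIV f" for c f
    proof (rule limI)
      have "A (\<lambda>x. c * f x) = (\<lambda>n. c * A f n)"
        by (intro ext) (simp add: A_def sum_distrib_left)
      then show "A (\<lambda>x. c * f x) \<longlonglongrightarrow> c * lim (A f)"
        by (simp add: tendsto_mult_left A that)
    qed
    show "0 \<le> lim (A f)" if "continuous_on UNIV f" "\<And>x. 0 \<le> f x" for f
      by (rule LIMSEQ_le_const[OF A[OF that(1)]]) (auto simp: A_def that(2) sum_nonneg)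
    show "lim (A (\<lambda>x. 1)) = 1"
    \<comment> \<open>The average at \<open>n = 0\<close> is 0 by the division convention, so
      equality holds only from 1 on.\<close>
    proof (rule limI, rule tendsto_eventually)
      show "\<forall>\<^sub>F n in sequentially. A (\<lambda>x. 1) n = 1"
        using eventually_gt_at_top[of 0] by eventually_elim (simp add: A_def)
    qed
  qed
  have "generic_seq z representing"
    unfolding generic_seq_iff borel_prob_def
  proof (intro conjI allI impI prob_space_representing sets_representing)
    show "(\<lambda>n. (\<Sum>j<n. f (z j)) / real n) \<longlonglongrightarrow> integral\<^sup>L representing f"
      if "continuous_on UNIV f" for f
      using A[OF that] unfolding integral_representing[OF that] by (simp add: A_def[abs_def])
  qed
  then show ?thesis ..
qed

section \<open>Gluing a Cauchy sequence\<close>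

text \<open>The removed points of \<open>D\<close> lie either all in \<open>{..<m}\<close> or all in the preimage of
  \<open>{..<m}\<close>, because \<open>\<pi>\<close> is monotone; hence only \<open>m\<close>, and not \<open>2 m\<close>, points are lost.\<close>

lemma fk_match_restrict:
  assumes "fk_match n \<delta> x z D R \<pi>"
  obtains D' R' where "fk_match n \<delta> x z D' R' \<pi>" "D' \<subseteq> {m..}" "R' \<subseteq> {m..}"
    "card D \<le> card D' + m"
proof
  have D: "D \<subseteq> {..<n}" and R: "R \<subseteq> {..<n}" and b: "bij_betw \<pi> D R" and mono: "mono_on D \<pi>"
    using assms by (auto simp: fk_match_def)
  let ?D = "{i \<in> D. m \<le> i \<and> m \<le> \<pi> i}"
  have "?D \<subseteq> D" by auto
  then have "bij_betw \<pi> ?D (\<pi> ` ?D)"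
    using b by (meson bij_betw_subset)
  moreover have "\<pi> ` ?D \<subseteq> R" using b by (auto simp: bij_betw_def)
  ultimately show "fk_match n \<delta> x z ?D (\<pi> ` ?D) \<pi>"
    using assms by (auto simp: fk_match_def intro: mono_on_subset)
  show "?D \<subseteq> {m..}" "\<pi> ` ?D \<subseteq> {m..}" by auto
  have finD: "finite D" using D by (auto intro: finite_subset)
  have "card (D - ?D) \<le> m"
  proof (cases "\<exists>i\<in>D. m \<le> i \<and> \<pi> i < m")
    case True
    then obtain i where i: "i \<in> D" "m \<le> i" "\<pi> i < m" by auto
    have "\<pi> j \<le> \<pi> i" if "j \<in> D" "j < m" for j
      using mono i that by (auto simp: mono_on_def)
    then have "\<pi> ` (D - ?D) \<subseteq> {..<m}" using i(3) by fastforce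
    then have "card (\<pi> ` (D - ?D)) \<le> m" using card_mono[of "{..<m}"] by auto
    moreover have "inj_on \<pi> (D - ?D)" using b by (auto simp: bij_betw_def intro: inj_on_subset)
    ultimately show ?thesis by (simp add: card_image)
  next
    case False
    then have "D - ?D \<subseteq> {..<m}" by force
    then show ?thesis using card_mono[of "{..<m}"] by fastforce
  qed
  moreover have "card (D - ?D) = card D - card ?D" using finD by (intro card_Diff_subset) auto
  ultimately show "card D \<le> card ?D + m" by simp
qed

text \<open>The first match stays below \<open>m\<close> in domain and range and the second at or
  above \<open>m\<close>, so order and injectivity survive at the junction.\<close>

lemma fk_match_union:
  assumes 1: "fk_match m \<delta> x z D\<^sub>1 R\<^sub>1 \<pi>\<^sub>1" and 2: "fk_match n \<delta> x z D\<^sub>2 R\<^sub>2 \<pi>\<^sub>2"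
    and "m \<le> n" "D\<^sub>2 \<subseteq> {m..}" "R\<^sub>2 \<subseteq> {m..}"
  shows "fk_match n \<delta> x z (D\<^sub>1 \<union> D\<^sub>2) (R\<^sub>1 \<union> R\<^sub>2) (\<lambda>i. if i < m then \<pi>\<^sub>1 i else \<pi>\<^sub>2 i)"
    (is "fk_match _ _ _ _ _ _ ?\<pi>")
proof -
  have D1: "D\<^sub>1 \<subseteq> {..<m}" and R1: "R\<^sub>1 \<subseteq> {..<m}"
    and b1: "bij_betw \<pi>\<^sub>1 D\<^sub>1 R\<^sub>1" and b2: "bij_betw \<pi>\<^sub>2 D\<^sub>2 R\<^sub>2"
    and m1: "mono_on D\<^sub>1 \<pi>\<^sub>1" and m2: "mono_on D\<^sub>2 \<pi>\<^sub>2"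
    using 1 2 by (auto simp: fk_match_def)
  have e1: "?\<pi> i = \<pi>\<^sub>1 i" if "i \<in> D\<^sub>1" for i using that D1 by auto
  have e2: "?\<pi> i = \<pi>\<^sub>2 i" if "i \<in> D\<^sub>2" for i using that assms(4) by auto
  have "bij_betw ?\<pi> D\<^sub>1 R\<^sub>1" "bij_betw ?\<pi> D\<^sub>2 R\<^sub>2"
    using b1 b2 bij_betw_cong[of D\<^sub>1 ?\<pi> \<pi>\<^sub>1] bij_betw_cong[of D\<^sub>2 ?\<pi> \<pi>\<^sub>2] e1 e2 by blast+
  then have b: "bij_betw ?\<pi> (D\<^sub>1 \<union> D\<^sub>2) (R\<^sub>1 \<union> R\<^sub>2)"
    by (rule bij_betw_combine) (use R1 assms(5) in force)
  have r1: "\<pi>\<^sub>1 i < m" if "i \<in> D\<^sub>1" for i using b1 R1 that by (auto simp: bij_betw_def)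
  have r2: "m \<le> \<pi>\<^sub>2 i" if "i \<in> D\<^sub>2" for i using b2 assms(5) that by (auto simp: bij_betw_def)
  have "mono_on (D\<^sub>1 \<union> D\<^sub>2) ?\<pi>"
  proof (rule mono_onI)
    fix r s assume rs: "r \<in> D\<^sub>1 \<union> D\<^sub>2" "s \<in> D\<^sub>1 \<union> D\<^sub>2" "r \<le> s"
    show "?\<pi> r \<le> ?\<pi> s"
    proof (cases "s \<in> D\<^sub>1")
      case True
      then have "s < m" using D1 by auto
      then have "r \<in> D\<^sub>1" using rs assms(4) by auto
      then show ?thesis
        using True m1 rs(3) unfolding e1[OF True] e1[OF \<open>r \<in> D\<^sub>1\<close>] by (auto simp: mono_on_def)
    next
      case False
      then have s: "s \<in> D\<^sub>2" using rs by auto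
      show ?thesis
      proof (cases "r \<in> D\<^sub>1")
        case True
        then show ?thesis unfolding e1[OF True] e2[OF s] using r1[OF True] r2[OF s] by simp
      next
        case False
        then have r: "r \<in> D\<^sub>2" using rs by auto
        show ?thesis unfolding e2[OF r] e2[OF s] using m2 r s rs(3) by (auto simp: mono_on_def)
      qed
    qed
  qed
  moreover have "dist (x i) (z (?\<pi> i)) < \<delta>" if "i \<in> D\<^sub>1 \<union> D\<^sub>2" for i
    using that 1 2 e1 e2 unfolding fk_match_def by (metis Un_iff)
  ultimately show ?thesis
    using 1 2 b \<open>m \<le> n\<close> by (auto simp: fk_match_def)
qed

lemma fk_match_cong:
  "fk_match n \<delta> x z D R \<pi> \<Longrightarrow> (\<And>j. j \<in> R \<Longrightarrow> z j = w j) \<Longrightarrow> fk_match n \<delta> x w D R \<pi>"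
  by (auto simp: fk_match_def bij_betw_def)

text \<open>Cutting the first match at \<open>a\<close> and the second at \<open>b\<close> costs at
  most \<open>a\<close> and \<open>b\<close> points. The nearly \<open>b\<close> points gained from
  the first match make up for the cut at \<open>b\<close>, which a loss of \<open>2 b\<close> would
  not allow.\<close>

lemma close_upto_glue:
  assumes u: "close_upto b \<delta> x u" and v: "close_upto n \<delta> x v"
    and "b \<le> n" and a: "real a \<le> \<delta> * real n" and "0 \<le> \<delta>"
    and zu: "\<And>j. a \<le> j \<Longrightarrow> j < b \<Longrightarrow> z j = u j" and zv: "\<And>j. b \<le> j \<Longrightarrow> j < n \<Longrightarrow> z j = v j"
  shows "close_upto n (3 * \<delta>) x z"
proof -
  obtain D\<^sub>1 R\<^sub>1 \<pi>\<^sub>1 where 1: "fk_match b \<delta> x u D\<^sub>1 R\<^sub>1 \<pi>\<^sub>1" "(1 - \<delta>) * real b \<le> real (card D\<^sub>1)"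
    using u by (auto simp: close_upto_def)
  obtain E\<^sub>1 S\<^sub>1 where E1: "fk_match b \<delta> x u E\<^sub>1 S\<^sub>1 \<pi>\<^sub>1" "S\<^sub>1 \<subseteq> {a..}" "card D\<^sub>1 \<le> card E\<^sub>1 + a"
    using fk_match_restrict[OF 1(1), of a] by metis
  have S1: "S\<^sub>1 \<subseteq> {..<b}" "E\<^sub>1 \<subseteq> {..<b}" using E1 by (auto simp: fk_match_def)
  have M1: "fk_match b \<delta> x z E\<^sub>1 S\<^sub>1 \<pi>\<^sub>1"
    by (rule fk_match_cong[OF E1(1)]) (use E1(2) S1 zu in force)
  obtain D\<^sub>2 R\<^sub>2 \<pi>\<^sub>2 where 2: "fk_match n \<delta> x v D\<^sub>2 R\<^sub>2 \<pi>\<^sub>2" "(1 - \<delta>) * real n \<le> real (card D\<^sub>2)"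
    using v by (auto simp: close_upto_def)
  obtain E\<^sub>2 S\<^sub>2 where E2: "fk_match n \<delta> x v E\<^sub>2 S\<^sub>2 \<pi>\<^sub>2" "E\<^sub>2 \<subseteq> {b..}" "S\<^sub>2 \<subseteq> {b..}"
    "card D\<^sub>2 \<le> card E\<^sub>2 + b"
    using fk_match_restrict[OF 2(1), of b] by metis
  have S2: "S\<^sub>2 \<subseteq> {..<n}" "E\<^sub>2 \<subseteq> {..<n}" using E2 by (auto simp: fk_match_def)
  have M2: "fk_match n \<delta> x z E\<^sub>2 S\<^sub>2 \<pi>\<^sub>2"
    by (rule fk_match_cong[OF E2(1)]) (use E2(3) S2 zv in force)
  have "E\<^sub>1 \<inter> E\<^sub>2 = {}" using S1(2) E2(2) by force
  then have card: "card (E\<^sub>1 \<union> E\<^sub>2) = card E\<^sub>1 + card E\<^sub>2"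
    using S1 S2 by (intro card_Un_disjoint) (auto intro: finite_subset)
  have "\<delta> * real b \<le> \<delta> * real n" using \<open>b \<le> n\<close> \<open>0 \<le> \<delta>\<close> by (intro mult_left_mono) auto
  \<comment> \<open>What is lost is \<open>\<delta> * b\<close>, \<open>\<delta> * n\<close> and
    \<open>a\<close>, each at most \<open>\<delta> * n\<close>; hence the factor 3.\<close>
  then have "(1 - 3 * \<delta>) * real n \<le> (1 - \<delta>) * real b + (1 - \<delta>) * real n - real a - real b"
    using a by (simp add: algebra_simps)
  also have "\<dots> \<le> real (card D\<^sub>1) + real (card D\<^sub>2) - real a - real b"
    using 1(2) 2(2) by simp
  also have "\<dots> \<le> real (card (E\<^sub>1 \<union> E\<^sub>2))"
    using E1(3) E2(4) unfolding card by linarith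
  finally have "(1 - 3 * \<delta>) * real n \<le> real (card (E\<^sub>1 \<union> E\<^sub>2))" .
  moreover have "fk_match n (3 * \<delta>) x z (E\<^sub>1 \<union> E\<^sub>2) (S\<^sub>1 \<union> S\<^sub>2) (\<lambda>i. if i < b then \<pi>\<^sub>1 i else \<pi>\<^sub>2 i)"
    using fk_match_mono[OF fk_match_union[OF M1 M2 \<open>b \<le> n\<close> E2(2,3)], of "3 * \<delta>"] \<open>0 \<le> \<delta>\<close> by simp
  ultimately show ?thesis unfolding close_upto_def by blast
qed

section \<open>Upper density and the glued sequence\<close>

lemma upper_density_nonneg: "0 \<le> upper_density A"
  unfolding upper_density_def
  by (intro le_Limsup) (auto simp: zero_ereal_def)

lemma upper_density_mono: "A \<subseteq> B \<Longrightarrow> upper_density A \<le> upper_density B"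
  unfolding upper_density_def
  by (intro Limsup_mono always_eventually allI) (auto intro!: divide_right_mono card_mono)

text \<open>\<open>lev j\<close> names the sequence followed at time \<open>j\<close>. If the
  \<open>y k\<close> are orbits, the glued sequence can break only where \<open>lev\<close> changes,
  so the first conclusion yields a quasi-orbit.\<close>

lemma fk_Cauchy_imp_glued_limit:
  fixes y :: "nat \<Rightarrow> nat \<Rightarrow> 'a::metric_space"
  assumes Cauchy: "\<And>\<epsilon>. 0 < \<epsilon> \<Longrightarrow> \<exists>N. \<forall>m\<ge>N. \<forall>n\<ge>N. fk (y m) (y n) < \<epsilon>"
  obtains lev where "upper_density {n. lev (Suc n) \<noteq> lev n} = 0"
    "(\<lambda>k. fk (y k) (\<lambda>j. y (lev j) j)) \<longlonglongrightarrow> 0"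
proof -
  \<comment> \<open>One threshold for level \<open>l\<close> serves all of the finitely many
    \<open>k \<le> l\<close>; the margin \<open>1 / Suc l\<close> makes the bound on
    \<open>fk\<close> strict and tends to 0.\<close>
  have "\<exists>N. \<forall>n\<ge>N. \<forall>k\<le>l. close_upto n (fk (y k) (y l) + 1 / real (Suc l)) (y k) (y l)" for l
  proof -
    have "\<forall>\<^sub>F n in sequentially. \<forall>k\<in>{..l}.
        close_upto n (fk (y k) (y l) + 1 / real (Suc l)) (y k) (y l)"
      by (intro eventually_ball_finite ballI eventually_close_upto) auto
    then show ?thesis by (auto simp: eventually_sequentially)
  qed
  then obtain N where N: "\<And>l n k. N l \<le> n \<Longrightarrow> k \<le> l \<Longrightarrow>
      close_upto n (fk (y k) (y l) + 1 / real (Suc l)) (y k) (y l)" by metis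
  \<comment> \<open>The three summands make \<open>m l\<close> at most a fraction
    \<open>1 / Suc l\<close> of \<open>m (Suc l)\<close>, put level \<open>Suc l\<close> beyond its
    matching threshold, and make the switching times at least quadratic in the level.\<close>
  define m where "m = rec_nat 0 (\<lambda>l v. Suc l * Suc v + N (Suc l) + (Suc l)\<^sup>2)"
  have m0: "m 0 = 0" and mSuc: "m (Suc l) = Suc l * Suc (m l) + N (Suc l) + (Suc l)\<^sup>2" for l
    by (simp_all add: m_def)
  \<comment> \<open>\<open>m 0 = 0\<close> puts every time into a block but may lie below
    \<open>N 0\<close>; level 0 is avoided later because \<open>p\<close> is a successor.\<close>
  have Nm: "N l \<le> m l" if "l \<noteq> 0" for l using that mSuc by (cases l) auto
  have sq: "l\<^sup>2 \<le> m l" for l by (cases l) (auto simp: m0 mSuc simp del: power_Suc)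
  have lacunary: "Suc l * m l \<le> m (Suc l)" for l by (simp add: mSuc)
  have "strict_mono m" by (rule strict_mono_Suc_iff[THEN iffD2]) (simp add: mSuc)
  then have m_mono: "m i \<le> m j" if "i \<le> j" for i j
    using that by (simp add: strict_mono_less_eq)
  have "\<exists>l. m l \<le> n \<and> n < m (Suc l)" for n
  proof -
    have "n < m (Suc n)" using sq[of "Suc n"] by (simp add: power2_eq_square)
    then have ex: "\<exists>i. n < m i" ..
    then have "n < m (LEAST i. n < m i)" by (rule LeastI_ex)
    moreover from this have "(LEAST i. n < m i) \<noteq> 0" by (metis m0 not_less0)
    then obtain l where l: "(LEAST i. n < m i) = Suc l" using not0_implies_Suc by blast
    moreover have "\<not> n < m l" using not_less_Least[of l "\<lambda>i. n < m i"] l by simp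
    ultimately show ?thesis by (auto simp: not_less)
  qed
  then obtain lev where lev: "\<And>n. m (lev n) \<le> n" "\<And>n. n < m (Suc (lev n))" by metis
  have lev_eqI: "lev n = l" if "m l \<le> n" "n < m (Suc l)" for n l
  proof (rule antisym)
    show "lev n \<le> l" using m_mono[of "Suc l" "lev n"] that lev[of n] by linarith
    show "l \<le> lev n" using m_mono[of "Suc (lev n)" l] that lev[of n] by linarith
  qed
  have lev_mono: "lev i \<le> lev j" if "i \<le> j" for i j
  proof (rule ccontr)
    assume "\<not> lev i \<le> lev j"
    then have "m (Suc (lev j)) \<le> m (lev i)" by (intro m_mono) simp
    then show False using lev[of i] lev[of j] that by linarith
  qed
  have "upper_density {n. lev (Suc n) \<noteq> lev n} \<le> 0"
  proof -
    let ?J = "{n. lev (Suc n) \<noteq> lev n}"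
    \<comment> \<open>A change of level at \<open>n\<close> forces \<open>Suc n\<close> to be a
      switching time, so the new level determines \<open>n\<close>.\<close>
    have jump: "Suc n = m (lev (Suc n))" if "n \<in> ?J" for n
    proof (rule ccontr)
      assume "Suc n \<noteq> m (lev (Suc n))"
      then have "m (lev (Suc n)) \<le> n" using lev(1)[of "Suc n"] by simp
      moreover have "n < m (Suc (lev (Suc n)))" using lev(2)[of "Suc n"] by simp
      ultimately have "lev n = lev (Suc n)" by (rule lev_eqI)
      then show False using that by simp
    qed
    have bound: "real (card (?J \<inter> {..<n})) / real n \<le> (sqrt (real n) + 1) / real n" for n
    proof -
      \<comment> \<open>Jumps before \<open>n\<close> are counted by the levels they enter, all at
        most \<open>lev n\<close>, which is at most the square root of \<open>n\<close>.\<close>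
      have "inj_on (\<lambda>j. lev (Suc j)) (?J \<inter> {..<n})"
        by (rule inj_onI) (metis IntD1 jump nat.inject)
      moreover have "(\<lambda>j. lev (Suc j)) ` (?J \<inter> {..<n}) \<subseteq> {..lev n}"
        by (auto intro: lev_mono)
      ultimately have "card (?J \<inter> {..<n}) \<le> card {..lev n}"
        by (intro card_inj_on_le) auto
      also have "card {..lev n} = lev n + 1" by simp
      finally have "real (card (?J \<inter> {..<n})) \<le> real (lev n) + 1" by linarith
      moreover have "real (lev n) \<le> sqrt (real n)"
      proof (rule real_le_rsqrt)
        have "(lev n)\<^sup>2 \<le> n" using sq[of "lev n"] lev(1)[of n] by simp
        then show "(real (lev n))\<^sup>2 \<le> real n" by (metis of_nat_mono of_nat_power)
      qed
      ultimately show ?thesis by (intro divide_right_mono) auto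
    qed
    have "(\<lambda>n. (sqrt (real n) + 1) / real n) \<longlonglongrightarrow> 0" by real_asymp
    then have "(\<lambda>n. ereal ((sqrt (real n) + 1) / real n)) \<longlonglongrightarrow> 0"
      by (simp add: zero_ereal_def)
    from lim_imp_Limsup[OF _ this]
    have "limsup (\<lambda>n. ereal ((sqrt (real n) + 1) / real n)) = 0" by simp
    then show ?thesis
      unfolding upper_density_def using bound
      by (metis (no_types, lifting) Limsup_mono always_eventually ereal_less_eq(3))
  qed
  then have "upper_density {n. lev (Suc n) \<noteq> lev n} = 0"
    using upper_density_nonneg by (simp add: antisym)
  moreover have "(\<lambda>k. fk (y k) (\<lambda>j. y (lev j) j)) \<longlonglongrightarrow> 0"
  proof (rule LIMSEQ_I)
    fix e :: real assume "0 < e"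
    \<comment> \<open>The Cauchy bound and the margin give \<open>2 * \<delta>\<close>, gluing
      triples it, and \<open>6 * \<delta> = e / 2\<close>.\<close>
    define \<delta> where "\<delta> = e / 12"
    have "0 < \<delta>" using \<open>0 < e\<close> by (simp add: \<delta>_def)
    then obtain K where K: "\<And>m n. m \<ge> K \<Longrightarrow> n \<ge> K \<Longrightarrow> fk (y m) (y n) < \<delta>"
      using Cauchy by blast
    have "fk (y k) (\<lambda>j. y (lev j) j) \<le> 3 * (2 * \<delta>)" if "k \<ge> K" for k
    proof (rule fk_le)
      obtain l\<^sub>0 :: nat where l\<^sub>0: "1 / real (Suc l\<^sub>0) < \<delta>"
        using nat_approx_posE[OF \<open>0 < \<delta>\<close>] by metis
      \<comment> \<open>Levels from \<open>p\<close> on are at least \<open>k\<close>, so their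
        thresholds cover \<open>y k\<close>, and at least \<open>l\<^sub>0\<close>, so their margins
        are below \<open>\<delta>\<close>.\<close>
      define p where "p = Suc (max k l\<^sub>0)"
      have small: "1 / real (Suc l) < \<delta>" if "p \<le> Suc l" for l
      proof -
        have "1 / real (Suc l) \<le> 1 / real (Suc l\<^sub>0)"
          using that by (intro divide_left_mono) (auto simp: p_def)
        then show ?thesis using l\<^sub>0 by simp
      qed
      have close: "close_upto n (2 * \<delta>) (y k) (y l)" if "p \<le> l" "m l \<le> n" for l n
      proof (rule close_upto_mono)
        show "close_upto n (fk (y k) (y l) + 1 / real (Suc l)) (y k) (y l)"
          using that Nm[of l] by (intro N) (auto simp: p_def)
        have "K \<le> l" using \<open>k \<ge> K\<close> that by (simp add: p_def)
        then show "fk (y k) (y l) + 1 / real (Suc l) \<le> 2 * \<delta>"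
          using K[OF \<open>k \<ge> K\<close>, of l] small[of l] that by linarith
      qed
      have "close_upto n (3 * (2 * \<delta>)) (y k) (\<lambda>j. y (lev j) j)" if "n \<ge> m (Suc p)" for n
      proof -
        have "Suc p \<le> lev n"
        proof (rule ccontr)
          assume "\<not> Suc p \<le> lev n"
          then have "m (Suc (lev n)) \<le> m (Suc p)" by (intro m_mono) simp
          then show False using lev(2)[of n] that by simp
        qed
        then obtain l where l: "lev n = Suc l" "p \<le> l" by (metis Suc_le_D Suc_le_mono)
        show ?thesis
        \<comment> \<open>Only the current level \<open>Suc l\<close> and the previous level
          \<open>l\<close> are used; the times before \<open>m l\<close> form at most a fraction
          \<open>1 / Suc l\<close> of \<open>n\<close>.\<close>
        proof (rule close_upto_glue[where a = "m l" and b = "m (Suc l)"])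
          show "close_upto (m (Suc l)) (2 * \<delta>) (y k) (y l)"
            using l m_mono by (intro close) auto
          show "close_upto n (2 * \<delta>) (y k) (y (Suc l))"
            using l lev(1)[of n] by (intro close) auto
          show "m (Suc l) \<le> n" using lev(1)[of n] l by simp
          have "real (Suc l) * real (m l) \<le> real n"
            using lacunary[of l] lev(1)[of n] l by (metis of_nat_mono of_nat_mult order_trans)
          then have "real (m l) \<le> 1 / real (Suc l) * real n" by (simp add: field_simps)
          also have "\<dots> \<le> 2 * \<delta> * real n"
            using small[of l] l \<open>0 < \<delta>\<close> by (intro mult_right_mono) auto
          finally show "real (m l) \<le> 2 * \<delta> * real n" .
          show "0 \<le> 2 * \<delta>" using \<open>0 < \<delta>\<close> by simp
          show "y (lev j) j = y l j" if "m l \<le> j" "j < m (Suc l)" for j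
            using lev_eqI[OF that] by simp
          show "y (lev j) j = y (Suc l) j" if "m (Suc l) \<le> j" "j < n" for j
            using lev_eqI[of "Suc l" j] that lev(2)[of n] l by simp
        qed
      qed
      then show "\<forall>\<^sub>F n in sequentially. close_upto n (3 * (2 * \<delta>)) (y k) (\<lambda>j. y (lev j) j)"
        by (auto simp: eventually_sequentially)
    qed (use \<open>0 < \<delta>\<close> in simp)
    moreover have "3 * (2 * \<delta>) < e" using \<open>0 < e\<close> by (simp add: \<delta>_def)
    ultimately have "norm (fk (y k) (\<lambda>j. y (lev j) j) - 0) < e" if "k \<ge> K" for k
      using that fk_nonneg[of "y k" "\<lambda>j. y (lev j) j"]
      by (simp only: real_norm_def diff_zero abs_of_nonneg) (rule le_less_trans)
    then show "\<exists>K. \<forall>k\<ge>K. norm (fk (y k) (\<lambda>j. y (lev j) j) - 0) < e" by blast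
  qed
  ultimately show ?thesis using that by blast
qed

section \<open>Invariant measures\<close>

lemma invariant_prob_if_integral_invariant:
  fixes T :: "'a::metric_space \<Rightarrow> 'a"
  assumes T: "continuous_on UNIV T" and \<mu>: "borel_prob \<mu>"
    and inv: "\<And>f :: 'a \<Rightarrow> real. continuous_on UNIV f \<Longrightarrow>
      integral\<^sup>L \<mu> (\<lambda>x. f (T x)) = integral\<^sup>L \<mu> f"
  shows "invariant_prob T \<mu>"
proof -
  interpret prob_space \<mu> using \<mu> by (simp add: borel_prob_def)
  have T': "T \<in> measurable \<mu> borel"
    using borel_measurable_continuous_onI[OF T] \<mu> by (simp add: borel_prob_def cong: measurable_cong_sets)
  have "distr \<mu> borel T = \<mu>"
  proof (rule borel_prob_eqI)
    show "borel_prob (distr \<mu> borel T)"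
      using prob_space_distr[OF T'] by (simp add: borel_prob_def)
    show "integral\<^sup>L (distr \<mu> borel T) f = integral\<^sup>L \<mu> f"
      if "continuous_on UNIV f" for f :: "'a \<Rightarrow> real"
      using integral_distr[OF T' borel_measurable_continuous_onI[OF that]] inv[OF that] by simp
  qed (rule \<mu>)
  then show ?thesis using \<mu> by (simp add: invariant_prob_def)
qed

lemma integral_invariant_prob:
  fixes f :: "'a::topological_space \<Rightarrow> real"
  assumes "invariant_prob T \<mu>" "continuous_on UNIV T" "continuous_on UNIV f"
  shows "integral\<^sup>L \<mu> (\<lambda>x. f (T x)) = integral\<^sup>L \<mu> f"
proof -
  have "T \<in> measurable \<mu> borel"
    using borel_measurable_continuous_onI[OF assms(2)] assms(1)
    by (simp add: invariant_prob_def borel_prob_def cong: measurable_cong_sets)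
  from integral_distr[OF this borel_measurable_continuous_onI[OF assms(3)]]
  show ?thesis using assms(1) by (simp add: invariant_prob_def)
qed

theorem corollary5p8:
  fixes T :: "'a::metric_space \<Rightarrow> 'a"
    and x :: "nat \<Rightarrow> 'a"
  assumes "compact (UNIV :: 'a set)"
    and "continuous_on UNIV T"
    and "fk_Cauchy T x"
    and "\<And>n. \<exists>\<nu>. invariant_prob T \<nu> \<and> generic_point T (x n) \<nu>"
  shows "\<exists>!\<mu>. invariant_prob T \<mu> \<and>
           (\<exists>z. quasi_orbit T z \<and> generic_seq z \<mu> \<and>
                (\<lambda>n. fk (trajectory T (x n)) z) \<longlonglongrightarrow> 0)"
proof (rule ex_ex1I)
  obtain \<nu> where \<nu>: "\<And>n. invariant_prob T (\<nu> n)" "\<And>n. generic_seq (trajectory T (x n)) (\<nu> n)"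
    using assms(4) unfolding generic_point_def by metis
  note lim_integral = fk_tendsto_imp_integral_tendsto[OF assms(1) \<nu>(2)]
  obtain lev where lev: "upper_density {n. lev (Suc n) \<noteq> lev n} = 0"
    "(\<lambda>k. fk (trajectory T (x k)) (\<lambda>j. trajectory T (x (lev j)) j)) \<longlonglongrightarrow> 0"
    using fk_Cauchy_imp_glued_limit[of "\<lambda>n. trajectory T (x n)"] assms(3)
    unfolding fk_Cauchy_def by blast
  define z where "z j = trajectory T (x (lev j)) j" for j
  have lim: "(\<lambda>k. fk (trajectory T (x k)) z) \<longlonglongrightarrow> 0"
    using lev(2) by (simp add: z_def[abs_def])
  \<comment> \<open>Where \<open>lev\<close> does not change, \<open>z\<close> stays on the
    trajectory of one point and advances by \<open>T\<close>.\<close>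
  have "{n. z (Suc n) \<noteq> T (z n)} \<subseteq> {n. lev (Suc n) \<noteq> lev n}"
    by (auto simp: z_def trajectory_def)
  from upper_density_mono[OF this] have "quasi_orbit T z"
    unfolding quasi_orbit_def lev(1) using upper_density_nonneg by (simp add: antisym)
  moreover obtain \<mu> where \<mu>: "generic_seq z \<mu>"
    using fk_tendsto_imp_generic_seq[OF assms(1) \<nu>(2) lim] by blast
  moreover have "invariant_prob T \<mu>"
  proof (rule invariant_prob_if_integral_invariant[OF assms(2)])
    show "borel_prob \<mu>" using \<mu> by (simp add: generic_seq_def)
    fix f :: "'a \<Rightarrow> real" assume cf: "continuous_on UNIV f"
    \<comment> \<open>The limit over \<open>k\<close> applies to f composed with T as well, and
      invariance of \<open>\<nu> k\<close> makes it the same sequence of integrals as for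
      \<open>f\<close>.\<close>
    have "continuous_on UNIV (\<lambda>x. f (T x))"
      using continuous_on_compose2[OF cf assms(2)] by simp
    from lim_integral[OF \<mu> lim this]
    have "(\<lambda>k. integral\<^sup>L (\<nu> k) f) \<longlonglongrightarrow> integral\<^sup>L \<mu> (\<lambda>x. f (T x))"
      by (simp add: integral_invariant_prob[OF \<nu>(1) assms(2) cf])
    then show "integral\<^sup>L \<mu> (\<lambda>x. f (T x)) = integral\<^sup>L \<mu> f"
      by (rule LIMSEQ_unique) (rule lim_integral[OF \<mu> lim cf])
  qed
  ultimately show "\<exists>\<mu>. invariant_prob T \<mu> \<and>
      (\<exists>z. quasi_orbit T z \<and> generic_seq z \<mu> \<and> (\<lambda>n. fk (trajectory T (x n)) z) \<longlonglongrightarrow> 0)"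
    using lim by blast
  fix \<mu> \<mu>'
  assume "invariant_prob T \<mu> \<and>
      (\<exists>z. quasi_orbit T z \<and> generic_seq z \<mu> \<and> (\<lambda>n. fk (trajectory T (x n)) z) \<longlonglongrightarrow> 0)"
    and "invariant_prob T \<mu>' \<and>
      (\<exists>z. quasi_orbit T z \<and> generic_seq z \<mu>' \<and> (\<lambda>n. fk (trajectory T (x n)) z) \<longlonglongrightarrow> 0)"
  then obtain z z' where z: "generic_seq z \<mu>" "(\<lambda>n. fk (trajectory T (x n)) z) \<longlonglongrightarrow> 0"
    and z': "generic_seq z' \<mu>'" "(\<lambda>n. fk (trajectory T (x n)) z') \<longlonglongrightarrow> 0" by blast
  \<comment> \<open>Whatever \<open>z\<close> and \<open>z'\<close> are, both integrals of
    \<open>f\<close> are limits of its integrals under the fixed \<open>\<nu> n\<close>.\<close>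
  show "\<mu> = \<mu>'"
  proof (rule borel_prob_eqI)
    show "borel_prob \<mu>" "borel_prob \<mu>'" using z(1) z'(1) by (auto simp: generic_seq_def)
    show "integral\<^sup>L \<mu> f = integral\<^sup>L \<mu>' f" if "continuous_on UNIV f" for f :: "'a \<Rightarrow> real"
      using lim_integral[OF z that] lim_integral[OF z' that] by (rule LIMSEQ_unique)
  qed
qed

end
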